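(* Consider the $(K,L,M_a,M_p,N)$-CW-MAP coded caching setting and let $R^{*}_{M_a,M_p}$ be its optimal worst-case rate (placement may be coded or uncoded). Then $$R^{*}_{M_a,M_p}\;\geq\;\max_{s\in\{1,\dots,K\}}\left(s-\frac{p\,M_a+s\,M_p}{\left\lfloor N/s\right\rfloor}\right),\qquad\text{where } p=p(s)=\min(s+L-1,K).$$
   Context: **The $(K,L,M_a,M_p,N)$-CW-MAP (cyclic wrap-around multi-access plus private) coded caching setting.** $K,L,N$ are positive integers with $1\le L\le K\le N$, and $M_a,M_p$ are real numbers in $[0,N]$. For an integer $a$, $\langle a\rangle_K$ denotes the representative of $a$ modulo $K$ in $\{1,\dots,K\}$. A server holds $N$ files $W_1,\dots,W_N$, each of $B$ bits (arbitrary; for information-theoretic arguments, independent and uniform on $\{0,1\}^B$). There are $K$ access caches, each of capacity $M_aB$ bits, and $K$ users, each with a private cache of capacity $M_pB$ bits. User $u\in\{1,\dots,K\}$ can read, at no cost, its own private cache and the $L$ access caches with indices $\langle u\rangle_K,\langle u+1\rangle_K,\dots,\langle u+L-1\rangle_K$. **Schemes.** A coded caching scheme with file size $B$ consists of: - placement: contents $\mathcal Z^a_k$ ($k\in\{1,\dots,K\}$) of the access caches and $\mathcal Z^p_u$ ($u\in\{1,\dots,K\}$) of the private caches, which are arbitrary functions of the files $(W_1,\dots,W_N)$, of at most $M_aB$ and $M_pB$ bits respectively, chosen without knowledge of the demands; - delivery: for each demand vector $\mathbf d=(d_1,\dots,d_K)\in\{1,\dots,N\}^K$, a broadcast message $X_{\mathbf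 d}$ of $R_{\mathbf d}B$ bits, a function of the files, received without error by all users, such that each user $u$ can recover $W_{d_u}$ from $X_{\mathbf d}$, $\mathcal Z^p_u$ and the $L$ access caches it reads. The worst-case rate of the scheme is $R=\max_{\mathbf d}R_{\mathbf d}$. The triple $(M_a,M_p,R)$ is achievable if, for some large enough file size $B$, there is a coded caching scheme with worst-case rate $R$ for the memory pair $(M_a,M_p)$. The optimal worst-case rate is $R^{*}_{M_a,M_p}=\inf\{R:(M_a,M_p,R)\text{ is achievable}\}$. *)

theory Defs
  imports Complex_Main "HOL-Library.FuncSet"
begin

text \<open>The representative of \<open>a\<close> modulo \<open>K\<close> in \<open>{1..K}\<close> rather than \<open>{0..<K}\<close>.\<close>

definition cyc :: "nat \<Rightarrow> nat \<Rightarrow> nat" where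
  "cyc K a = (if a mod K = 0 then K else a mod K)"

definition libraries :: "nat \<Rightarrow> nat \<Rightarrow> (nat \<Rightarrow> bool list) set" where
  "libraries N B = {1..N} \<rightarrow>\<^sub>E {w. length w = B}"

definition demands :: "nat \<Rightarrow> nat \<Rightarrow> (nat \<Rightarrow> nat) set" where
  "demands K N = {1..K} \<rightarrow>\<^sub>E {1..N}"

text \<open>
  The number of bits of a cache content or message is a fixed length that does not depend on
  the realisation of the files. Letting it vary would let the length itself carry
  information that is not accounted for in the number of bits.
\<close>

definition uses_bits ::
  "nat \<Rightarrow> nat \<Rightarrow> ((nat \<Rightarrow> bool list) \<Rightarrow> bool list) \<Rightarrow> nat \<Rightarrow> bool" where
  "uses_bits N B f n \<longleftrightarrow> (\<forall>W\<in>libraries N B. length (f W) = n)"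

definition read_caches ::
  "nat \<Rightarrow> nat \<Rightarrow> (nat \<Rightarrow> (nat \<Rightarrow> bool list) \<Rightarrow> bool list) \<Rightarrow> nat \<Rightarrow> (nat \<Rightarrow> bool list) \<Rightarrow> bool list list" where
  "read_caches K L Za u W = map (\<lambda>i. Za (cyc K (u + i)) W) [0..<L]"

text \<open>
  \<open>Za k\<close> and \<open>Zp u\<close> are the placement maps of the access and private caches, \<open>X d\<close> the
  delivery map for the demand vector \<open>d\<close>, and \<open>x d\<close> the number of bits of the message \<open>X d W\<close>.
  The decoder may depend on \<open>d\<close> and \<open>u\<close>, but not on the files.
\<close>

definition caching_scheme ::
  "nat \<Rightarrow> nat \<Rightarrow> real \<Rightarrow> real \<Rightarrow> nat \<Rightarrow> nat
   \<Rightarrow> (nat \<Rightarrow> (nat \<Rightarrow> bool list) \<Rightarrow> bool list)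
   \<Rightarrow> (nat \<Rightarrow> (nat \<Rightarrow> bool list) \<Rightarrow> bool list)
   \<Rightarrow> ((nat \<Rightarrow> nat) \<Rightarrow> (nat \<Rightarrow> bool list) \<Rightarrow> bool list)
   \<Rightarrow> ((nat \<Rightarrow> nat) \<Rightarrow> nat) \<Rightarrow> bool" where
  "caching_scheme K L Ma Mp N B Za Zp X x \<longleftrightarrow>
     (\<forall>k\<in>{1..K}. \<exists>n. uses_bits N B (Za k) n \<and> real n \<le> Ma * real B) \<and>
     (\<forall>u\<in>{1..K}. \<exists>n. uses_bits N B (Zp u) n \<and> real n \<le> Mp * real B) \<and>
     (\<forall>d\<in>demands K N. uses_bits N B (X d) (x d)) \<and>
     (\<forall>d\<in>demands K N. \<forall>u\<in>{1..K}.
        \<exists>dec :: bool list \<Rightarrow> bool list \<Rightarrow> bool list list \<Rightarrow> bool list.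
          \<forall>W\<in>libraries N B. dec (X d W) (Zp u W) (read_caches K L Za u W) = W (d u))"

definition worst_case_rate :: "nat \<Rightarrow> nat \<Rightarrow> nat \<Rightarrow> ((nat \<Rightarrow> nat) \<Rightarrow> nat) \<Rightarrow> real" where
  "worst_case_rate K N B x = Max ((\<lambda>d. real (x d) / real B) ` demands K N)"

definition achievable :: "nat \<Rightarrow> nat \<Rightarrow> nat \<Rightarrow> real \<Rightarrow> real \<Rightarrow> real \<Rightarrow> bool" where
  "achievable K L N Ma Mp R \<longleftrightarrow>
     (\<exists>B>0. \<exists>Za Zp X x. caching_scheme K L Ma Mp N B Za Zp X x \<and> R = worst_case_rate K N B x)"

text \<open>
  For \<open>0 \<le> Ma\<close>, \<open>0 \<le> Mp\<close> and \<open>N \<ge> 1\<close> the set below is nonempty (send all requested files) and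
  bounded below by \<open>0\<close>, so the real-valued infimum is a genuine one.
\<close>

definition optimal_rate :: "nat \<Rightarrow> nat \<Rightarrow> nat \<Rightarrow> real \<Rightarrow> real \<Rightarrow> real" where
  "optimal_rate K L N Ma Mp = Inf {R. achievable K L N Ma Mp R}"

end

(* Cut-set argument: users 1..s jointly see at most min (s + L - 1) K access caches, and with
   floor (N / s) broadcasts, for demands that partition the first s * floor (N / s) files,
   they recover all of those files. Counting the realisations of these files bounds the total
   number of bits that they see from below. *)

theory Submission
  imports Defs
begin

lemma card_bool_lists_length: "card {w :: bool list. length w = n} = 2 ^ n"
  using card_lists_length_eq[of "UNIV :: bool set" n] by simp

lemma finite_bool_lists_length: "finite {w :: bool list. length w = n}"
  using finite_lists_length_eq[of "UNIV :: bool set" n] by simp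

text \<open>This is a pigeonhole substitute for an entropy argument: with the files outside
  \<open>J\<close> frozen, the observations indexed by \<open>I\<close> determine the files in
  \<open>J\<close>, so the \<open>2 ^ (B * card J)\<close> possible contents inject into the
  \<open>2 ^ sum n I\<close> possible tuples of observations. The index type is left arbitrary so
  that messages and caches can be observed together.\<close>

lemma uses_bits_counting_bound:
  assumes "finite I" and "J \<subseteq> {1..N}"
    and bits: "\<And>i. i \<in> I \<Longrightarrow> uses_bits N B (f i) (n i)"
    and det: "\<And>W W'. \<lbrakk>W \<in> libraries N B; W' \<in> libraries N B; \<And>i. i \<in> I \<Longrightarrow> f i W = f i W'\<rbrakk>
      \<Longrightarrow> \<forall>j\<in>J. W j = W' j"
  shows "B * card J \<le> sum n I"
proof -
  define G where "G = J \<rightarrow>\<^sub>E {w :: bool list. length w = B}"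
  define S where "S = (\<Pi>\<^sub>E i\<in>I. {w :: bool list. length w = n i})"
  \<comment> \<open>The observations are functions of a whole library, so the files outside
    \<open>J\<close> are filled with a constant word of the right length.\<close>
  define ext where
    "ext V = (\<lambda>j\<in>{1..N}. if j \<in> J then V j else replicate B False)" for V :: "nat \<Rightarrow> bool list"
  define F where "F V = (\<lambda>i\<in>I. f i (ext V))" for V
  have "finite J" using assms(2) finite_subset by blast
  have ext: "ext V \<in> libraries N B" if "V \<in> G" for V
    using that by (auto simp: G_def ext_def libraries_def PiE_iff)
  have "F ` G \<subseteq> S"
    using bits ext by (fastforce simp: F_def S_def uses_bits_def)
  moreover have "inj_on F G"
  proof (rule inj_onI)
    fix V V' assume V: "V \<in> G" "V' \<in> G" and eq: "F V = F V'"
    have "f i (ext V) = f i (ext V')" if "i \<in> I" for i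
      using fun_cong[OF eq, of i] that by (simp add: F_def)
    then have "\<forall>j\<in>J. ext V j = ext V' j" using det ext V by blast
    then have "V j = V' j" if "j \<in> J" for j
      using that subsetD[OF assms(2) that] by (auto simp: ext_def)
    then show "V = V'" using V unfolding G_def by (blast intro: PiE_ext)
  qed
  moreover have "finite S"
    unfolding S_def using \<open>finite I\<close> by (intro finite_PiE finite_bool_lists_length)
  ultimately have "card G \<le> card S" by (metis card_inj_on_le)
  moreover have "card G = 2 ^ (B * card J)"
    using \<open>finite J\<close> by (simp add: G_def card_PiE card_bool_lists_length power_mult)
  moreover have "card S = 2 ^ sum n I"
    using \<open>finite I\<close> by (simp add: S_def card_PiE card_bool_lists_length power_sum)
  ultimately show ?thesis by simp
qed

lemma cyc_in_range: "K \<ge> 1 \<Longrightarrow> cyc K a \<in> {1..K}"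
  by (auto simp: cyc_def Suc_le_eq intro: less_imp_le)

lemma finite_demands: "finite (demands K N)"
  by (simp add: demands_def finite_PiE)

lemma achievable_rate_bound:
  assumes "1 \<le> L" and "K \<le> N" and "0 \<le> Ma" and s: "s \<in> {1..K}"
    and ach: "achievable K L N Ma Mp R"
  shows "R \<ge> real s - (real (min (s + L - 1) K) * Ma + real s * Mp) / real (N div s)"
proof -
  obtain B Za Zp X x where "B > 0" and scheme: "caching_scheme K L Ma Mp N B Za Zp X x"
    and R: "R = worst_case_rate K N B x"
    using ach unfolding achievable_def by blast
  obtain na where na: "\<And>k. k \<in> {1..K} \<Longrightarrow> uses_bits N B (Za k) (na k) \<and> real (na k) \<le> Ma * real B"
    using scheme unfolding caching_scheme_def by metis
  obtain np where np: "\<And>u. u \<in> {1..K} \<Longrightarrow> uses_bits N B (Zp u) (np u) \<and> real (np u) \<le> Mp * real B"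
    using scheme unfolding caching_scheme_def by metis
  have bits_X: "uses_bits N B (X d) (x d)" if "d \<in> demands K N" for d
    using scheme that unfolding caching_scheme_def by blast
  have decode: "\<exists>dec. \<forall>W\<in>libraries N B. dec (X d W) (Zp u W) (read_caches K L Za u W) = W (d u)"
    if "d \<in> demands K N" "u \<in> {1..K}" for d u
    using scheme that unfolding caching_scheme_def by blast

  define m where "m = N div s"
  define p where "p = min (s + L - 1) K"
  \<comment> \<open>User \<open>u\<close> reads the caches \<open>cyc K (u + i)\<close> with
    \<open>i < L\<close>; for \<open>u \<le> s\<close> the argument runs through 1 up to
    \<open>s + L - 1\<close>. Wrap-around can make indices coincide, whence the second bound
    \<open>K\<close> in \<open>p\<close>.\<close>
  define C where "C = cyc K ` {1..s + L - 1}"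
  \<comment> \<open>Broadcast \<open>j\<close> serves the \<open>j\<close>-th block of
    \<open>s\<close> consecutive files to users 1 to \<open>s\<close>. The other users ask for file
    1 merely to complete a valid demand vector.\<close>
  define dem where "dem j = (\<lambda>u\<in>{1..K}. if u \<le> s then j * s + u else 1)" for j
  have K: "K \<ge> 1" and s1: "1 \<le> s" "s \<le> K" using s by auto
  \<comment> \<open>The first part permits the final division by \<open>m\<close>; the second
    ensures that every file in the \<open>m\<close> blocks exists.\<close>
  have m: "m \<ge> 1" "m * s \<le> N"
    using s1 \<open>K \<le> N\<close> by (auto simp: m_def div_greater_zero_iff Suc_le_eq)
  have dem: "dem j \<in> demands K N" if "j < m" for j
  proof -
    have "j * s + u \<le> N" if "u \<le> s" for u
    proof -
      have "j * s + u \<le> Suc j * s" using that by simp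
      also have "\<dots> \<le> m * s" using \<open>j < m\<close> by (intro mult_le_mono1) simp
      finally show ?thesis using m by simp
    qed
    then show ?thesis using K \<open>K \<le> N\<close> by (auto simp: dem_def demands_def)
  qed
  have "C \<subseteq> {1..K}" unfolding C_def using cyc_in_range[OF K] by blast
  moreover have "card C \<le> s + L - 1"
    unfolding C_def using card_image_le[of "{1..s + L - 1}" "cyc K"] by simp
  ultimately have card_C: "card C \<le> p"
    unfolding p_def using card_mono[of "{1..K}" C] by simp

  \<comment> \<open>The disjoint sum tags broadcasts, private caches and access caches, whose
    numerical indices overlap.\<close>
  define I where "I = {..<m} <+> ({1..s} <+> C)"
  define f where "f = case_sum (\<lambda>j. X (dem j)) (case_sum Zp Za)"
  define n where "n = case_sum (\<lambda>j. x (dem j)) (case_sum np na)"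
  have "finite C" by (simp add: C_def)
  have "B * card {1..m * s} \<le> sum n I"
  proof (rule uses_bits_counting_bound[where f = f and N = N])
    show "finite I" using \<open>finite C\<close> by (simp add: I_def)
    show "{1..m * s} \<subseteq> {1..N}" using m by simp
    show "uses_bits N B (f i) (n i)" if "i \<in> I" for i
      using that bits_X dem na np \<open>C \<subseteq> {1..K}\<close> s1 by (auto simp: I_def f_def n_def)
    show "\<forall>j\<in>{1..m * s}. W j = W' j"
      if W: "W \<in> libraries N B" "W' \<in> libraries N B"
        and eq: "\<And>i. i \<in> I \<Longrightarrow> f i W = f i W'" for W W'
    proof
      fix a assume a: "a \<in> {1..m * s}"
      \<comment> \<open>Files count from 1 and broadcasts from 0, so dividing \<open>a - 1\<close>
        by \<open>s\<close> with remainder inverts \<open>j * s + u\<close>.\<close>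
      define j where "j = (a - 1) div s"
      define u where "u = (a - 1) mod s + 1"
      have "a - 1 < m * s" using a by auto
      then have j: "j < m" by (simp add: j_def less_mult_imp_div_less)
      have u: "u \<in> {1..s}" using s1 by (auto simp: u_def Suc_le_eq)
      have "j * s + (a - 1) mod s = a - 1" by (simp add: j_def)
      then have "dem j u = a" using a u s1 by (simp add: dem_def u_def)
      have "X (dem j) W = X (dem j) W'"
        using eq[of "Inl j"] j by (simp add: I_def f_def InlI InrI)
      moreover have "Zp u W = Zp u W'"
        using eq[of "Inr (Inl u)"] u by (simp add: I_def f_def InlI InrI)
      moreover have "read_caches K L Za u W = read_caches K L Za u W'"
      proof -
        have "Za (cyc K (u + i)) W = Za (cyc K (u + i)) W'" if "i < L" for i
        proof -
          have "cyc K (u + i) \<in> C" using u that unfolding C_def by (intro imageI) auto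
          then show ?thesis
            using eq[of "Inr (Inr (cyc K (u + i)))"] by (simp add: I_def f_def InlI InrI)
        qed
        then show ?thesis by (simp add: read_caches_def)
      qed
      moreover have "u \<in> {1..K}" using u s1 by simp
      \<comment> \<open>One decoder serves both libraries and receives the same inputs from each,
        hence returns the same file.\<close>
      ultimately have "W (dem j u) = W' (dem j u)"
        using decode[OF dem[OF j]] W by metis
      then show "W a = W' a" using \<open>dem j u = a\<close> by simp
    qed
  qed
  also have "sum n I = (\<Sum>j<m. x (dem j)) + (sum np {1..s} + sum na C)"
    using \<open>finite C\<close> by (simp add: I_def n_def sum.Plus comp_def)
  finally have "real (B * (m * s)) \<le> real ((\<Sum>j<m. x (dem j)) + (sum np {1..s} + sum na C))"
    by (simp only: of_nat_le_iff card_atLeastAtMost diff_Suc_1)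
  also have "\<dots> = (\<Sum>j<m. real (x (dem j))) + (\<Sum>u\<in>{1..s}. real (np u)) + (\<Sum>k\<in>C. real (na k))"
    by simp
  also have "\<dots> \<le> (\<Sum>j<m. R * B) + (\<Sum>u\<in>{1..s}. Mp * B) + (\<Sum>k\<in>C. Ma * B)"
  proof (intro add_mono sum_mono)
    fix j assume "j \<in> {..<m}"
    then have "real (x (dem j)) / B \<le> R"
      unfolding R worst_case_rate_def using dem finite_demands by (intro Max_ge) auto
    then show "real (x (dem j)) \<le> R * B" using \<open>B > 0\<close> by (simp add: field_simps)
  qed (use np na s1 \<open>C \<subseteq> {1..K}\<close> in auto)
  \<comment> \<open>Replacing \<open>card C\<close> by its upper bound \<open>p\<close> does not
    decrease the sum because \<open>Ma\<close> is nonnegative.\<close>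
  also have "\<dots> \<le> m * (R * B) + s * (Mp * B) + p * (Ma * B)"
    using card_C \<open>0 \<le> Ma\<close> by (simp add: mult_right_mono)
  finally have "real B * (m * s) \<le> real B * (m * R + s * Mp + p * Ma)"
    by (simp add: algebra_simps)
  then have "real m * s \<le> m * R + s * Mp + p * Ma"
    using \<open>B > 0\<close> by simp
  then have "real s - (p * Ma + s * Mp) / m \<le> R"
    using m by (simp add: field_simps)
  then show ?thesis by (simp add: m_def p_def)
qed

text \<open>Bounding the real \<open>Inf\<close> from below by \<open>cInf_greatest\<close> requires
  a nonempty set of rates. The witness has one-bit files, empty caches and a message listing the
  \<open>K\<close> requested bits.\<close>

lemma ex_achievable:
  assumes "0 \<le> Ma" and "0 \<le> Mp"
  shows "\<exists>R. achievable K L N Ma Mp R"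
proof -
  \<comment> \<open>Since \<open>B = 1\<close>, \<open>hd\<close> extracts the whole file; the
    request of user \<open>u\<close> sits at the zero-based position \<open>u - 1\<close>.\<close>
  define X where "X d W = map (\<lambda>i. hd (W (d (Suc i)))) [0..<K]"
    for d :: "nat \<Rightarrow> nat" and W :: "nat \<Rightarrow> bool list"
  have "[X d W ! (u - 1)] = W (d u)"
    if "d \<in> demands K N" "u \<in> {1..K}" "W \<in> libraries N 1" for d u W
  proof -
    have "d u \<in> {1..N}" using that unfolding demands_def by blast
    then have "length (W (d u)) = 1" using that unfolding libraries_def by blast
    moreover have "X d W ! (u - 1) = hd (W (d u))"
      using that by (cases u) (auto simp: X_def)
    ultimately show ?thesis by (cases "W (d u)") auto
  qed
  then have "\<exists>dec. \<forall>W\<in>libraries N 1. dec (X d W) [] (read_caches K L (\<lambda>_ _. []) u W) = W (d u)"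
    if "d \<in> demands K N" "u \<in> {1..K}" for d u
    using that by (intro exI[of _ "\<lambda>y _ _. [y ! (u - 1)]"]) blast
  then have "caching_scheme K L Ma Mp N 1 (\<lambda>_ _. []) (\<lambda>_ _. []) X (\<lambda>_. K)"
    using assms unfolding caching_scheme_def
    by (intro conjI ballI exI[of _ 0]) (auto simp: uses_bits_def X_def)
  then show ?thesis unfolding achievable_def by (metis zero_less_one)
qed

theorem theorem1:
  fixes K L N :: nat and Ma Mp :: real
  assumes "1 \<le> L" and "L \<le> K" and "K \<le> N"
    and "0 \<le> Ma" and "Ma \<le> real N"
    and "0 \<le> Mp" and "Mp \<le> real N"
  shows "optimal_rate K L N Ma Mp \<ge>
    Max ((\<lambda>s. let p = min (s + L - 1) K in
            real s - (real p * Ma + real s * Mp) / real_of_int \<lfloor>real N / real s\<rfloor>) ` {1..K})"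
  unfolding optimal_rate_def
proof (rule cInf_greatest)
  show "{R. achievable K L N Ma Mp R} \<noteq> {}"
    using ex_achievable assms by blast
  fix R assume "R \<in> {R. achievable K L N Ma Mp R}"
  \<comment> \<open>The maximum is bounded for each \<open>s\<close> separately, with
    \<open>floor_divide_of_nat_eq\<close> identifying the real floor with
    \<open>N div s\<close>.\<close>
  then show "Max ((\<lambda>s. let p = min (s + L - 1) K in
      real s - (real p * Ma + real s * Mp) / real_of_int \<lfloor>real N / real s\<rfloor>) ` {1..K}) \<le> R"
    using achievable_rate_bound[of L K N Ma _ Mp R] assms
    by (auto simp: Let_def floor_divide_of_nat_eq)
qed

end
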